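(* For $i=1,\dots,m$ let $A_i\in\mathbb{R}^{\ell\times n}$, $b_i\in\mathbb{R}^{\ell}$, suppose $U_i=\{u\in\mathbb{R}^n: A_iu\le b_i\}$ is nonempty and bounded, and let $h_i(x)=\max_{u\in U_i}u^Tx$. Let $x\in\mathbb{R}^n$ and $\omega>0$. Then the proximal quasi-Newton subproblem $$\min_{d\in\mathbb{R}^n}\ \max_{i=1,\dots,m}\left\{\nabla g_i(x)^Td+\tfrac12d^TB_i(x)d+h_i(x+d)-h_i(x)\right\}+\tfrac{\omega}{2}\|d\|^2$$ is equivalent to the quadratic minimization problem with quadratic inequality constraints $$\min_{\mu\in\mathbb{R},\,d\in\mathbb{R}^n,\,w_1,\dots,w_m\in\mathbb{R}^{\ell}}\ \mu+\tfrac{\omega}{2}\|d\|^2$$ $$\text{s.t. }\ \nabla g_i(x)^Td+\tfrac12d^TB_i(x)d+b_i^Tw_i-h_i(x)\le\mu,\quad A_i^Tw_i=x+d,\quad w_i\ge0,\quad i=1,\dots,m,$$ in the sense that the two problems have the same optimal value and $d$ solves the first problem if and only if there exist $\mu,w_1,\dots,w_m$ such that $(\mu,d,w_1,\dots,w_m)$ solves the second.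
   Context: For each $i$, $g_i:\mathbb{R}^n\to\mathbb{R}$ is twice continuously differentiable and strongly convex, and $B_i(x)\in\mathbb{R}^{n\times n}$ is a symmetric positive definite matrix (an approximation of $\nabla^2g_i(x)$). Vector inequalities are componentwise and $\|\cdot\|$ is the Euclidean norm. *)

theory Defs
  imports "HOL-Analysis.Analysis"
begin

definition gradient :: "('a::real_inner \<Rightarrow> real) \<Rightarrow> 'a \<Rightarrow> 'a" where
  "gradient f x = (SOME D. GDERIV f x :> D)"

definition twice_cont_differentiable :: "(real^'n \<Rightarrow> real) \<Rightarrow> bool" where
  "twice_cont_differentiable f \<longleftrightarrow>
     (\<forall>x. f differentiable (at x)) \<and>
     (\<exists>H :: real^'n \<Rightarrow> real^'n^'n.
        (\<forall>x. (gradient f has_derivative (\<lambda>v. H x *v v)) (at x)) \<and> continuous_on UNIV H)"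

definition strongly_convex :: "('a::real_normed_vector \<Rightarrow> real) \<Rightarrow> bool" where
  "strongly_convex f \<longleftrightarrow>
     (\<exists>\<sigma>>0. \<forall>x y. \<forall>t\<in>{0..1}.
        f (t *\<^sub>R x + (1 - t) *\<^sub>R y)
          \<le> t * f x + (1 - t) * f y - \<sigma> / 2 * t * (1 - t) * (norm (x - y))\<^sup>2)"

definition sym_pos_def :: "real^'n^'n \<Rightarrow> bool" where
  "sym_pos_def M \<longleftrightarrow> transpose M = M \<and> (\<forall>v. v \<noteq> 0 \<longrightarrow> v \<bullet> (M *v v) > 0)"

(* The order on real^'l is the componentwise one. *)
definition polyhedron_le :: "real^'n^'l \<Rightarrow> real^'l \<Rightarrow> (real^'n) set" where
  "polyhedron_le A b = {u. A *v u \<le> b}"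

(* GREATEST expresses a maximum rather than a supremum; it is meaningful only if the maximum is
   attained, as it is for nonempty compact U. *)
definition support_fun :: "'a::real_inner set \<Rightarrow> 'a \<Rightarrow> real" where
  "support_fun U x = (GREATEST v. \<exists>u\<in>U. v = u \<bullet> x)"

(* Extended reals, so that infeasible and unbounded problems have a value too. *)
definition optimal_value :: "('a \<Rightarrow> real) \<Rightarrow> 'a set \<Rightarrow> ereal" where
  "optimal_value f S = (INF z\<in>S. ereal (f z))"

definition optimal_solution :: "('a \<Rightarrow> real) \<Rightarrow> 'a set \<Rightarrow> 'a \<Rightarrow> bool" where
  "optimal_solution f S z \<longleftrightarrow> is_arg_min f (\<lambda>y. y \<in> S) z"

definition prox_objective ::
  "('m::finite \<Rightarrow> real^'n \<Rightarrow> real) \<Rightarrow> ('m \<Rightarrow> real^'n \<Rightarrow> real^'n^'n) \<Rightarrow>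
   ('m \<Rightarrow> real^'n \<Rightarrow> real) \<Rightarrow> real \<Rightarrow> real^'n \<Rightarrow> real^'n \<Rightarrow> real" where
  "prox_objective g B h \<omega> x d =
     Max (range (\<lambda>i. gradient (g i) x \<bullet> d + 1 / 2 * (d \<bullet> (B i x *v d)) + h i (x + d) - h i x))
     + \<omega> / 2 * (norm d)\<^sup>2"

definition qp_objective :: "real \<Rightarrow> real \<times> (real^'n) \<times> ('m \<Rightarrow> real^'l) \<Rightarrow> real" where
  "qp_objective \<omega> = (\<lambda>(\<mu>, d, w). \<mu> + \<omega> / 2 * (norm d)\<^sup>2)"

definition qp_feasible ::
  "('m::finite \<Rightarrow> real^'n \<Rightarrow> real) \<Rightarrow> ('m \<Rightarrow> real^'n \<Rightarrow> real^'n^'n) \<Rightarrow>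
   ('m \<Rightarrow> real^'n \<Rightarrow> real) \<Rightarrow> ('m \<Rightarrow> real^'n^'l) \<Rightarrow> ('m \<Rightarrow> real^'l) \<Rightarrow> real^'n \<Rightarrow>
   (real \<times> (real^'n) \<times> ('m \<Rightarrow> real^'l)) set" where
  "qp_feasible g B h A b x =
     {(\<mu>, d, w). \<forall>i.
        gradient (g i) x \<bullet> d + 1 / 2 * (d \<bullet> (B i x *v d)) + b i \<bullet> w i - h i x \<le> \<mu> \<and>
        transpose (A i) *v w i = x + d \<and>
        0 \<le> w i}"

end

theory Submission
  imports Defs
begin

text \<open>For a nonempty bounded polyhedron, linear programming duality gives
  \<open>h y = min {b \<bullet> w | A\<^sup>T w = y, w \<ge> 0}\<close>. So the projection \<open>(\<mu>, d, w) \<mapsto> d\<close> maps the feasible set of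
  the quadratic program onto the whole space, never increasing the objective, and the value at each
  \<open>d\<close> is attained on the fibre over \<open>d\<close>. Strong duality is obtained by separating \<open>(y, h y)\<close> from
  the finitely generated, hence closed, cone of all pairs \<open>(A\<^sup>T w, b \<bullet> w + s)\<close>
  with \<open>w \<ge> 0\<close> and \<open>s \<ge> 0\<close>.\<close>

section \<open>Matrix identities and the componentwise order\<close>

lemma axis_vector_matrix_mult:
  fixes A :: "real^'n^'l"
  shows "axis i 1 v* A = A $ i"
  by (simp add: matrix_vector_mult_basis column_def transpose_def vec_eq_iff
      flip: transpose_matrix_vector)

lemma inner_transpose_matrix_vector:
  fixes A :: "real^'n^'l"
  shows "u \<bullet> (transpose A *v w) = (A *v u) \<bullet> w"
  by (metis dot_lmul_matrix inner_commute vector_transpose_matrix transpose_transpose)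

lemma inner_nonneg_left_mono:
  fixes p q w :: "real^'l"
  assumes "p \<le> q" and "0 \<le> w"
  shows "p \<bullet> w \<le> q \<bullet> w"
  using assms unfolding inner_vec_def less_eq_vec_def
  by (auto intro!: sum_mono mult_right_mono)

section \<open>Polyhedra, support functions and recession directions\<close>

lemma closed_polyhedron_le: "closed (polyhedron_le A b)"
proof -
  have "polyhedron_le A b = (\<Inter>i. {u. (A $ i) \<bullet> u \<le> b $ i})"
    by (auto simp: polyhedron_le_def less_eq_vec_def matrix_vector_mul_component)
  then show ?thesis
    by (simp add: closed_INT closed_halfspace_le)
qed

text \<open>The extreme value theorem supplies a maximizer, and only then does
  \<open>GREATEST\<close> denote the maximum.\<close>

lemma support_fun_attained:
  fixes U :: "'a::real_inner set"
  assumes "compact U" and "U \<noteq> {}"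
  obtains u where "u \<in> U" and "support_fun U y = u \<bullet> y"
proof -
  have "continuous_on U (\<lambda>u. u \<bullet> y)"
    by (intro continuous_intros)
  then obtain u where u: "u \<in> U" "\<And>v. v \<in> U \<Longrightarrow> v \<bullet> y \<le> u \<bullet> y"
    using continuous_attains_sup[OF assms] by blast
  have "support_fun U y = u \<bullet> y"
    unfolding support_fun_def by (rule Greatest_equality) (use u in auto)
  with u(1) show ?thesis by (rule that)
qed

lemma support_fun_upper:
  fixes U :: "'a::real_inner set"
  assumes "compact U" and "u \<in> U"
  shows "u \<bullet> y \<le> support_fun U y"
proof -
  have "continuous_on U (\<lambda>u. u \<bullet> y)"
    by (intro continuous_intros)
  then obtain v where v: "v \<in> U" "\<And>u. u \<in> U \<Longrightarrow> u \<bullet> y \<le> v \<bullet> y"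
    using continuous_attains_sup[OF assms(1)] assms(2) by blast
  have "support_fun U y = v \<bullet> y"
    unfolding support_fun_def by (rule Greatest_equality) (use v in auto)
  with v(2)[OF assms(2)] show ?thesis by simp
qed

lemma bounded_recession_zero:
  fixes v :: "'a::real_normed_vector"
  assumes "bounded S" and "\<And>s. 0 \<le> s \<Longrightarrow> u + s *\<^sub>R v \<in> S"
  shows "v = 0"
proof (rule ccontr)
  assume v: "v \<noteq> 0"
  obtain K where K: "\<And>z. z \<in> S \<Longrightarrow> norm z \<le> K"
    using assms(1) by (auto simp: bounded_iff)
  have "norm u \<le> K"
    using K[OF assms(2)[of 0]] by simp
  then have K0: "0 \<le> K"
    by (rule order_trans[OF norm_ge_zero])
  \<comment> \<open>This makes the norm of \<open>s *\<^sub>R v\<close> exceed by 1 the bound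
    \<open>K + norm u\<close> that the triangle inequality imposes.\<close>
  define s where "s = (K + norm u + 1) / norm v"
  have s: "0 \<le> s"
    using K0 by (simp add: s_def)
  have "norm (s *\<^sub>R v) = K + norm u + 1"
    using v K0 by (simp add: s_def)
  moreover have "norm (s *\<^sub>R v) \<le> norm (u + s *\<^sub>R v) + norm u"
    using norm_triangle_ineq4[of "u + s *\<^sub>R v" u] by simp
  ultimately show False
    using K[OF assms(2)[OF s]] by simp
qed

section \<open>Linear programming duality\<close>

lemma weak_duality:
  assumes "compact (polyhedron_le A b)" and "polyhedron_le A b \<noteq> {}"
    and "transpose A *v w = y" and "0 \<le> w"
  shows "support_fun (polyhedron_le A b) y \<le> b \<bullet> w"
proof -
  obtain u where u: "u \<in> polyhedron_le A b" "support_fun (polyhedron_le A b) y = u \<bullet> y"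
    using support_fun_attained[OF assms(1,2)] .
  have "u \<bullet> y = (A *v u) \<bullet> w"
    using assms(3) inner_transpose_matrix_vector by metis
  also have "\<dots> \<le> b \<bullet> w"
    using u(1) assms(4) by (simp add: polyhedron_le_def inner_nonneg_left_mono)
  finally show ?thesis using u(2) by simp
qed

lemma strong_duality:
  fixes A :: "real^'n^'l"
  assumes bdd: "bounded (polyhedron_le A b)" and ne: "polyhedron_le A b \<noteq> {}"
  obtains w where "transpose A *v w = y" and "0 \<le> w"
    and "b \<bullet> w \<le> support_fun (polyhedron_le A b) y"
proof -
  let ?U = "polyhedron_le A b"
  let ?h = "support_fun ?U y"
  have cpt: "compact ?U"
    using bdd closed_polyhedron_le by (simp add: compact_eq_bounded_closed)
  \<comment> \<open>The rows with their right-hand sides generate the pairs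
    \<open>(transpose A *v w, b \<bullet> w)\<close>; \<open>(0, 1)\<close> adds the slack in the
    last coordinate. Finiteness of \<open>S\<close> makes its conic hull \<open>C\<close> closed,
    while membership in the explicit cone \<open>K\<close> yields multipliers, so the inclusion of
    \<open>C\<close> in \<open>K\<close> links the two.\<close>
  define S where "S = insert (0, 1) (range (\<lambda>i. (A $ i, b $ i)))"
  define C where "C = convex_cone hull S"
  define K where "K = (\<lambda>(w, s). (transpose A *v w, b \<bullet> w + s)) ` ({w. 0 \<le> w} \<times> {0::real..})"
  have linK: "linear (\<lambda>(w, s). (transpose A *v w, b \<bullet> w + s))"
    by (rule linearI)
      (auto simp: matrix_vector_right_distrib matrix_vector_mult_scaleR inner_add_right algebra_simps
        simp del: transpose_matrix_vector)
  have "convex_cone ({w::real^'l. 0 \<le> w} \<times> {0::real..})"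
    by (auto simp: convex_cone_iff less_eq_vec_def zero_prod_def)
  then have ccK: "convex_cone K"
    unfolding K_def using linK convex_cone_linear_image by blast
  have "S \<subseteq> K"
  proof
    fix p assume "p \<in> S"
    then consider "p = (0, 1)" | i where "p = (A $ i, b $ i)"
      by (auto simp: S_def)
    then show "p \<in> K"
    proof cases
      case 1
      then show ?thesis
        unfolding K_def by (intro image_eqI[of _ _ "(0, 1)"]) auto
    next
      case 2
      \<comment> \<open>The unit vector with slack 0 selects row \<open>i\<close>. Since the
        simplifier turns \<open>transpose A *v w\<close> into \<open>w v* A\<close>,
        \<open>axis_vector_matrix_mult\<close> is phrased with \<open>v*\<close>.\<close>
      have "0 \<le> (axis i 1 :: real^'l)"
        by (simp add: less_eq_vec_def axis_def)
      with 2 show ?thesis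
        unfolding K_def
        by (intro image_eqI[of _ _ "(axis i 1, 0)"])
          (auto simp: axis_vector_matrix_mult inner_axis)
    qed
  qed
  then have CK: "C \<subseteq> K"
    unfolding C_def using ccK by (rule hull_minimal)
  have "(y, ?h) \<in> C"
  proof (rule ccontr)
    assume "(y, ?h) \<notin> C"
    moreover have "closed C"
      unfolding C_def by (rule closed_convex_cone_hull) (simp add: S_def)
    moreover have "convex C"
      unfolding C_def by (rule convex_convex_cone_hull)
    ultimately obtain a \<beta> where sep: "a \<bullet> (y, ?h) < \<beta>" "\<And>p. p \<in> C \<Longrightarrow> \<beta> < a \<bullet> p"
      using separating_hyperplane_closed_point by metis
    have \<beta>: "\<beta> < 0"
      using sep(2)[of 0] by (simp add: C_def convex_cone_hull_contains_0)
    have pos: "0 \<le> a \<bullet> p" if "p \<in> C" for p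
    proof (rule ccontr)
      assume neg: "\<not> 0 \<le> a \<bullet> p"
      \<comment> \<open>Scaling \<open>p\<close> by \<open>c\<close> brings the functional to
        exactly \<open>\<beta>\<close>, against the strict separation.\<close>
      define c where "c = \<beta> / (a \<bullet> p)"
      have "0 \<le> c"
        using neg \<beta> by (simp add: c_def divide_nonpos_nonpos)
      then have "c *\<^sub>R p \<in> C"
        using that unfolding C_def by (simp add: convex_cone_hull_mul)
      from sep(2)[OF this] show False
        using neg by (simp add: c_def)
    qed
    \<comment> \<open>Nonnegativity on the generators means \<open>t \<ge> 0\<close> and
      \<open>A *v (- v) \<le> t *\<^sub>R b\<close>. So \<open>- v\<close> is a recession direction
      of the polyhedron if \<open>t = 0\<close>, and \<open>- v / t\<close> is one of its points if
      \<open>t > 0\<close>.\<close>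
    obtain v t where a: "a = (v, t)" by (cases a)
    have "(0, 1) \<in> C" and gen: "(A $ i, b $ i) \<in> C" for i
      unfolding C_def S_def by (auto intro: hull_inc)
    then have t: "0 \<le> t"
      using pos[of "(0, 1)"] by (simp add: a)
    have row: "- (A *v v) $ i \<le> t * b $ i" for i
      using pos[OF gen[of i]] by (simp add: a matrix_vector_mul_component inner_commute)
    have neg: "v \<bullet> y + t * ?h < 0"
      using sep(1) \<beta> by (simp add: a)
    show False
    proof (cases "t = 0")
      case True
      \<comment> \<open>The ray from \<open>u\<close> along \<open>- v\<close> stays in the bounded
        polyhedron, so \<open>v = 0\<close>, which contradicts
        \<open>v \<bullet> y < 0\<close>.\<close>
      obtain u where u: "u \<in> ?U" using ne by blast
      have "u + s *\<^sub>R (- v) \<in> ?U" if "0 \<le> s" for s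
      proof -
        have "(A *v (u + s *\<^sub>R (- v))) $ i \<le> b $ i" for i
        proof -
          have "(A *v (u + s *\<^sub>R (- v))) $ i = (A *v u) $ i + s * (- (A *v v) $ i)"
            by (simp add: matrix_vector_mult_diff_distrib matrix_vector_mult_scaleR)
          also have "\<dots> \<le> b $ i + s * 0"
            using u row[of i] True that
            by (intro add_mono mult_left_mono) (auto simp: polyhedron_le_def less_eq_vec_def)
          finally show ?thesis by simp
        qed
        then show ?thesis by (simp add: polyhedron_le_def less_eq_vec_def)
      qed
      then have "- v = 0" by (rule bounded_recession_zero[OF bdd])
      then show False using neg True by simp
    next
      case False
      with t have t0: "0 < t" by simp
      \<comment> \<open>By \<open>neg\<close>, the feasible point \<open>- v / t\<close> would have
        an inner product with \<open>y\<close> above the maximum \<open>?h\<close>.\<close>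
      have "(A *v ((- 1 / t) *\<^sub>R v)) $ i \<le> b $ i" for i
        unfolding matrix_vector_mult_scaleR using row[of i] t0 by (simp add: field_simps)
      then have "(- 1 / t) *\<^sub>R v \<in> ?U"
        by (simp add: polyhedron_le_def less_eq_vec_def)
      from support_fun_upper[OF cpt this, of y] have "- (v \<bullet> y) / t \<le> ?h"
        by simp
      then have "- (v \<bullet> y) \<le> t * ?h"
        using t0 by (simp only: pos_divide_le_eq mult.commute)
      then show False
        using neg by simp
    qed
  qed
  with CK obtain w s where ws: "0 \<le> w" "0 \<le> s" "transpose A *v w = y" "b \<bullet> w + s = ?h"
    unfolding K_def by auto
  show ?thesis
    by (rule that[of w]) (use ws in auto)
qed

section \<open>Transfer of optima along a projection\<close>

lemma optimal_solution_iff: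
  "optimal_solution f S z \<longleftrightarrow> z \<in> S \<and> (\<forall>y\<in>S. f z \<le> f y)"
  by (auto simp: optimal_solution_def is_arg_min_linorder)

text \<open>Partial minimization: together, \<open>below\<close> and \<open>lift\<close> say that
  \<open>F d\<close> is the attained minimum of \<open>G\<close> over the fibre of
  \<open>\<pi>\<close> above \<open>d\<close>. Attainment is what carries over minimizers as well as
  values.\<close>

context
  fixes F :: "'a \<Rightarrow> real" and G :: "'b \<Rightarrow> real" and S :: "'b set" and \<pi> :: "'b \<Rightarrow> 'a"
  assumes below: "\<And>z. z \<in> S \<Longrightarrow> F (\<pi> z) \<le> G z"
    and lift: "\<And>d. \<exists>z\<in>S. \<pi> z = d \<and> G z \<le> F d"
begin

lemma optimal_value_lift: "optimal_value F UNIV = optimal_value G S"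
  unfolding optimal_value_def
proof (rule antisym)
  show "(INF d. ereal (F d)) \<le> (INF z\<in>S. ereal (G z))"
    by (rule INF_mono) (use below in auto)
  show "(INF z\<in>S. ereal (G z)) \<le> (INF d. ereal (F d))"
    by (rule INF_mono) (use lift in auto)
qed

lemma optimal_solution_lift:
  "optimal_solution F UNIV d \<longleftrightarrow> (\<exists>z. \<pi> z = d \<and> optimal_solution G S z)"
proof
  assume opt: "optimal_solution F UNIV d"
  obtain z where z: "z \<in> S" "\<pi> z = d" "G z \<le> F d"
    using lift by blast
  \<comment> \<open>The chain is \<open>G z \<le> F d \<le> F (\<pi> y) \<le> G y\<close>.\<close>
  have "G z \<le> G y" if "y \<in> S" for y
    using z(3) opt below[OF that] by (meson UNIV_I optimal_solution_iff order_trans)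
  with z show "\<exists>z. \<pi> z = d \<and> optimal_solution G S z"
    by (auto simp: optimal_solution_iff)
next
  assume "\<exists>z. \<pi> z = d \<and> optimal_solution G S z"
  then obtain z where z: "\<pi> z = d" "z \<in> S" "\<And>y. y \<in> S \<Longrightarrow> G z \<le> G y"
    by (auto simp: optimal_solution_iff)
  \<comment> \<open>With a lift \<open>y\<close> of \<open>e\<close>, the chain is
    \<open>F d \<le> G z \<le> G y \<le> F e\<close>.\<close>
  have "F d \<le> F e" for e
    using lift[of e] below[OF z(2)] z by force
  then show "optimal_solution F UNIV d"
    by (simp add: optimal_solution_iff)
qed

end

theorem mainTheorem3:
  fixes g :: "'m::finite \<Rightarrow> real^'n \<Rightarrow> real"
    and B :: "'m \<Rightarrow> real^'n \<Rightarrow> real^'n^'n"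
    and A :: "'m \<Rightarrow> real^'n^'l"
    and b :: "'m \<Rightarrow> real^'l"
    and U :: "'m \<Rightarrow> (real^'n) set"
    and h :: "'m \<Rightarrow> real^'n \<Rightarrow> real"
    and x :: "real^'n"
    and \<omega> :: real
  assumes "\<And>i. twice_cont_differentiable (g i)"
    and "\<And>i. strongly_convex (g i)"
    and "\<And>i y. sym_pos_def (B i y)"
    and "\<And>i. U i = polyhedron_le (A i) (b i)"
    and "\<And>i. U i \<noteq> {}"
    and "\<And>i. bounded (U i)"
    and "\<And>i y. h i y = support_fun (U i) y"
    and "\<omega> > 0"
  shows "optimal_value (prox_objective g B h \<omega> x) UNIV
           = optimal_value (qp_objective \<omega>) (qp_feasible g B h A b x)
       \<and> (\<forall>d. optimal_solution (prox_objective g B h \<omega> x) UNIV d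
           \<longleftrightarrow> (\<exists>\<mu> w. optimal_solution (qp_objective \<omega>) (qp_feasible g B h A b x) (\<mu>, d, w)))"
proof -
  have ne: "polyhedron_le (A i) (b i) \<noteq> {}" for i
    using assms(5)[of i] unfolding assms(4) .
  have bdd: "bounded (polyhedron_le (A i) (b i))" for i
    using assms(6)[of i] unfolding assms(4) .
  have cpt: "compact (polyhedron_le (A i) (b i))" for i
    using bdd closed_polyhedron_le by (simp add: compact_eq_bounded_closed)
  have h: "h i y = support_fun (polyhedron_le (A i) (b i)) y" for i y
    unfolding assms(7) assms(4) ..
  let ?F = "prox_objective g B h \<omega> x"
  let ?G = "qp_objective \<omega> :: real \<times> (real^'n) \<times> ('m \<Rightarrow> real^'l) \<Rightarrow> real"
  let ?S = "qp_feasible g B h A b x"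
  let ?\<pi> = "\<lambda>z :: real \<times> (real^'n) \<times> ('m \<Rightarrow> real^'l). fst (snd z)"
  define q where "q i d = gradient (g i) x \<bullet> d + 1 / 2 * (d \<bullet> (B i x *v d))" for i d
  have F: "?F d = Max (range (\<lambda>i. q i d + h i (x + d) - h i x)) + \<omega> / 2 * (norm d)\<^sup>2" for d
    by (simp add: prox_objective_def q_def)
  have S: "(\<mu>, d, w) \<in> ?S \<longleftrightarrow>
      (\<forall>i. q i d + b i \<bullet> w i - h i x \<le> \<mu> \<and> transpose (A i) *v w i = x + d \<and> 0 \<le> w i)" for \<mu> d w
    by (simp add: qp_feasible_def q_def)
  \<comment> \<open>Weak duality at \<open>x + d\<close> puts every term of the maximum below
    \<open>\<mu>\<close>.\<close>
  have below: "?F (?\<pi> z) \<le> ?G z" if "z \<in> ?S" for z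
  proof -
    obtain \<mu> d w where z: "z = (\<mu>, d, w)" by (cases z)
    have "q i d + h i (x + d) - h i x \<le> \<mu>" for i
    proof -
      have feas: "q i d + b i \<bullet> w i - h i x \<le> \<mu>" "transpose (A i) *v w i = x + d" "0 \<le> w i"
        using that S z by auto
      from weak_duality[OF cpt ne feas(2,3)] feas(1) show ?thesis by (simp add: h)
    qed
    then show ?thesis
      by (auto simp: z F qp_objective_def)
  qed
  have lift: "\<exists>z\<in>?S. ?\<pi> z = d \<and> ?G z \<le> ?F d" for d
  proof -
    \<comment> \<open>Strong duality is applied separately for each \<open>i\<close>; the choice of
      \<open>w\<close> as a function of \<open>i\<close> follows.\<close>
    have "\<exists>w. transpose (A i) *v w = x + d \<and> 0 \<le> w \<and> b i \<bullet> w \<le> h i (x + d)" for i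
      unfolding h by (rule strong_duality[OF bdd[of i] ne, of "x + d"]) blast
    then obtain w where w: "\<And>i. transpose (A i) *v w i = x + d" "\<And>i. 0 \<le> w i"
        "\<And>i. b i \<bullet> w i \<le> h i (x + d)"
      by metis
    \<comment> \<open>The maximum itself is the least \<open>\<mu>\<close> feasible for this
      \<open>d\<close>, so the two objectives agree at the lifted point.\<close>
    define \<mu> where "\<mu> = Max (range (\<lambda>i. q i d + h i (x + d) - h i x))"
    have "q i d + b i \<bullet> w i - h i x \<le> \<mu>" for i
    proof -
      have "q i d + h i (x + d) - h i x \<le> \<mu>"
        unfolding \<mu>_def by (rule Max_ge) auto
      with w(3)[of i] show ?thesis by simp
    qed
    with w have "(\<mu>, d, w) \<in> ?S"
      by (simp add: S)
    then show ?thesis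
      by (rule rev_bexI) (simp add: qp_objective_def F \<mu>_def)
  qed
  have "(\<exists>z. ?\<pi> z = d \<and> optimal_solution ?G ?S z)
      \<longleftrightarrow> (\<exists>\<mu> w. optimal_solution ?G ?S (\<mu>, d, w))" for d
    by auto
  then show ?thesis
    using optimal_value_lift[of ?S ?F ?\<pi> ?G, OF below lift]
      optimal_solution_lift[of ?S ?F ?\<pi> ?G, OF below lift]
    by simp
qed

end
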